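(* Let $G=(V,E)$ be a finite graph and let $\theta:\mathbb{Z}_2\to\mathrm{Aut}(G)$ act freely on $V$. Let $S_1,S_2$ be proper linear subspaces of $\mathbb{R}^{d+1}$ with $\dim S_1=k_1$, $\dim S_2=k_2$, $k_1+k_2=d+1$ and $S_1\cap S_2=\{0\}$, and let $X$ be a (possibly empty) subset of $V$. Then the following are equivalent: (a) $G$ can be realised as an infinitesimally rigid (resp. forced $\mathbb{Z}_2$-symmetric infinitesimally rigid) $\mathbb{Z}_2$-symmetric bar-joint framework on $\mathbb{S}^d$ with respect to $\theta$ and $\tau:\mathbb{Z}_2\to\mathcal{C}_{\iota_{S_1}}$, where the points assigned to $X$ lie on a great circle. (b) $G$ can be realised as an infinitesimally rigid (resp. forced $\mathbb{Z}_2$-symmetric infinitesimally rigid) $\mathbb{Z}_2$-symmetric bar-joint framework on $\mathbb{S}^d$ with respect to $\theta$ and $\tau':\mathbb{Z}_2\to\mathcal{C}_{\iota_{S_2}}$, where the points assigned to $X$ lie on a great circle.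
   Context: For a proper linear subspace $S$ of $\mathbb{R}^{d+1}$, $\iota_S$ denotes inversion in $S$: the orthogonal involution fixing $S$ pointwise and acting as $-1$ on its orthogonal complement; $\mathcal{C}_{\iota_S}=\{I,\iota_S\}$, and $\tau,\tau'$ are isomorphisms onto these groups. Spherical (bar-joint) framework $(G,q)$ on $\mathbb{S}^d$: $q:V\to\mathbb{S}^d$ with image spanning $\mathbb{R}^{d+1}$; infinitesimal motions $\dot q:V\to\mathbb{R}^{d+1}$ with $\langle q_i,\dot q_j\rangle+\langle q_j,\dot q_i\rangle=0$ for $\{i,j\}\in E$ and $\langle q_i,\dot q_i\rangle=0$; trivial motions $\dot q_i=Sq_i$, $S$ skew-symmetric; infinitesimally rigid iff all motions trivial (motion space of dimension $\binom{d+1}{2}$). $\mathbb{Z}_2$-symmetric w.r.t. $\theta,\rho$: $\rho(\gamma)q(i)=q(\theta(\gamma)i)$; a motion is $\mathbb{Z}_2$-symmetric if $\rho(\gamma)\dot q_i=\dot q_{\theta(\gamma)i}$; forced $\mathbb{Z}_2$-symmetric infinitesimally rigid: every $\mathbb{Z}_2$-symmetric motion is trivial. A great circle is the intersection of $\mathbb{S}^d$ with a 2-dimensional linear subspace. *)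

theory Defs
  imports "HOL-Analysis.Analysis" "HOL-Algebra.Elementary_Groups" "HOL-Algebra.Bij"
begin

abbreviation Z2 :: "int monoid" where
  "Z2 \<equiv> integer_mod_group 2"

definition finite_graph :: "'v set \<Rightarrow> 'v set set \<Rightarrow> bool" where
  "finite_graph V E \<longleftrightarrow> finite V \<and> (\<forall>e\<in>E. e \<subseteq> V \<and> card e = 2)"

text \<open>\<open>Bij\<close> and \<open>BijGroup\<close> use extensional functions, so automorphisms are \<open>undefined\<close> off \<open>V\<close>.\<close>

definition graph_Aut :: "'v set \<Rightarrow> 'v set set \<Rightarrow> ('v \<Rightarrow> 'v) monoid" where
  "graph_Aut V E = BijGroup V
     \<lparr>carrier := {f \<in> Bij V. \<forall>i\<in>V. \<forall>j\<in>V. {f i, f j} \<in> E \<longleftrightarrow> {i, j} \<in> E}\<rparr>"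

definition acts_freely :: "(int \<Rightarrow> 'v \<Rightarrow> 'v) \<Rightarrow> 'v set \<Rightarrow> bool" where
  "acts_freely \<theta> V \<longleftrightarrow> (\<forall>\<gamma>\<in>carrier Z2. \<gamma> \<noteq> \<one>\<^bsub>Z2\<^esub> \<longrightarrow> (\<forall>i\<in>V. \<theta> \<gamma> i \<noteq> i))"

definition inversion :: "(real^'n) set \<Rightarrow> real^'n \<Rightarrow> real^'n" where
  "inversion S = (THE f. orthogonal_transformation f \<and> f \<circ> f = id \<and>
                         (\<forall>x\<in>S. f x = x) \<and> (\<forall>x\<in>S\<^sup>\<bottom>. f x = - x))"

definition inversion_group :: "(real^'n) set \<Rightarrow> (real^'n \<Rightarrow> real^'n) monoid" where
  "inversion_group S = \<lparr>carrier = {id, inversion S}, mult = (\<circ>), one = id\<rparr>"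

definition spherical_framework :: "'v set \<Rightarrow> ('v \<Rightarrow> real^'n) \<Rightarrow> bool" where
  "spherical_framework V q \<longleftrightarrow> q \<in> V \<rightarrow> sphere 0 1 \<and> span (q ` V) = UNIV"

definition infinitesimal_motion ::
  "'v set \<Rightarrow> 'v set set \<Rightarrow> ('v \<Rightarrow> real^'n) \<Rightarrow> ('v \<Rightarrow> real^'n) \<Rightarrow> bool" where
  "infinitesimal_motion V E q q' \<longleftrightarrow>
     (\<forall>i\<in>V. \<forall>j\<in>V. {i, j} \<in> E \<longrightarrow> q i \<bullet> q' j + q j \<bullet> q' i = 0) \<and>
     (\<forall>i\<in>V. q i \<bullet> q' i = 0)"

definition trivial_motion ::
  "'v set \<Rightarrow> ('v \<Rightarrow> real^'n) \<Rightarrow> ('v \<Rightarrow> real^'n) \<Rightarrow> bool" where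
  "trivial_motion V q q' \<longleftrightarrow> (\<exists>A :: real^'n^'n. transpose A = - A \<and> (\<forall>i\<in>V. q' i = A *v q i))"

definition infinitesimally_rigid ::
  "'v set \<Rightarrow> 'v set set \<Rightarrow> ('v \<Rightarrow> real^'n) \<Rightarrow> bool" where
  "infinitesimally_rigid V E q \<longleftrightarrow>
     (\<forall>q'. infinitesimal_motion V E q q' \<longrightarrow> trivial_motion V q q')"

text \<open>Applied both to placements and to infinitesimal motions.\<close>

definition Z2_symmetric ::
  "'v set \<Rightarrow> (int \<Rightarrow> 'v \<Rightarrow> 'v) \<Rightarrow> (int \<Rightarrow> real^'n \<Rightarrow> real^'n) \<Rightarrow> ('v \<Rightarrow> real^'n) \<Rightarrow> bool" where
  "Z2_symmetric V \<theta> \<rho> p \<longleftrightarrow> (\<forall>\<gamma>\<in>carrier Z2. \<forall>i\<in>V. \<rho> \<gamma> (p i) = p (\<theta> \<gamma> i))"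

definition forced_Z2_symmetric_infinitesimally_rigid ::
  "'v set \<Rightarrow> 'v set set \<Rightarrow> (int \<Rightarrow> 'v \<Rightarrow> 'v) \<Rightarrow> (int \<Rightarrow> real^'n \<Rightarrow> real^'n) \<Rightarrow>
   ('v \<Rightarrow> real^'n) \<Rightarrow> bool" where
  "forced_Z2_symmetric_infinitesimally_rigid V E \<theta> \<rho> q \<longleftrightarrow>
     (\<forall>q'. infinitesimal_motion V E q q' \<and> Z2_symmetric V \<theta> \<rho> q' \<longrightarrow> trivial_motion V q q')"

definition great_circle :: "(real^'n) set \<Rightarrow> bool" where
  "great_circle C \<longleftrightarrow> (\<exists>W. subspace W \<and> dim W = 2 \<and> C = sphere 0 1 \<inter> W)"

lemma inversion_ex1:
  fixes S :: "(real^'n) set"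
  assumes S: "subspace S"
  shows "\<exists>!f. orthogonal_transformation f \<and> f \<circ> f = id \<and>
              (\<forall>x\<in>S. f x = x) \<and> (\<forall>x\<in>S\<^sup>\<bottom>. f x = - x)"
proof -
  have dec: "\<exists>y z. y \<in> S \<and> z \<in> S\<^sup>\<bottom> \<and> x = y + z" for x
    using subspace_sum_orthogonal_comp[OF S] set_plus_elim[of x S "S\<^sup>\<bottom>"] by (metis UNIV_I)
  then obtain P Q where PQ: "\<And>x. P x \<in> S" "\<And>x. Q x \<in> S\<^sup>\<bottom>" "\<And>x. x = P x + Q x"
    by metis
  have So: "subspace (S\<^sup>\<bottom>)" by (rule subspace_orthogonal_comp)
  have uniq: "y = P x \<and> z = Q x" if "y \<in> S" "z \<in> S\<^sup>\<bottom>" "x = y + z" for x y z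
  proof (rule orthogonal_subspace_decomp_unique[of _ _ _ _ S "S\<^sup>\<bottom>"])
    show "y + z = P x + Q x" using that PQ(3)[of x] by metis
  qed (use that PQ(1,2) S So in \<open>auto simp: span_eq_iff[THEN iffD2] orthogonal_comp_def\<close>)
  have orth: "P x \<bullet> Q y = 0" for x y
    using PQ(1)[of x] PQ(2)[of y] by (auto simp: orthogonal_comp_def orthogonal_def)
  define f where "f = (\<lambda>x. P x - Q x)"
  have lP: "P (x + y) = P x + P y \<and> Q (x + y) = Q x + Q y" for x y
  proof -
    have "x + y = (P x + Q x) + (P y + Q y)" using PQ(3) by metis
    then have "x + y = (P x + P y) + (Q x + Q y)" by (simp add: add_ac)
    then show ?thesis
      using uniq[of "P x + P y" "Q x + Q y" "x + y"] subspace_add[OF S PQ(1) PQ(1)]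
        subspace_add[OF So PQ(2) PQ(2)] by metis
  qed
  have lS: "P (c *\<^sub>R x) = c *\<^sub>R P x \<and> Q (c *\<^sub>R x) = c *\<^sub>R Q x" for c x
  proof -
    have "c *\<^sub>R x = c *\<^sub>R (P x + Q x)" using PQ(3) by metis
    then have "c *\<^sub>R x = c *\<^sub>R P x + c *\<^sub>R Q x" by (simp add: scaleR_add_right)
    then show ?thesis
      using uniq[of "c *\<^sub>R P x" "c *\<^sub>R Q x" "c *\<^sub>R x"] subspace_scale[OF S PQ(1)]
        subspace_scale[OF So PQ(2)] by metis
  qed
  have "linear f"
    by (rule linearI) (simp_all add: f_def lP lS algebra_simps)
  moreover have "f v \<bullet> f w = v \<bullet> w" for v w
  proof -
    have "v \<bullet> w = (P v + Q v) \<bullet> (P w + Q w)" using PQ(3) by metis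
    then show ?thesis
      using orth[of v w] orth[of w v] by (simp add: f_def inner_simps inner_commute)
  qed
  moreover have f1: "f x = x" if "x \<in> S" for x
    using uniq[of x 0 x] that So by (simp add: f_def subspace_0)
  moreover have f2: "f x = - x" if "x \<in> S\<^sup>\<bottom>" for x
    using uniq[of 0 x x] that S by (simp add: f_def subspace_0)
  moreover have "f \<circ> f = id"
  proof
    fix x
    have "f x = P x + (- Q x)" by (simp add: f_def)
    then have "P x = P (f x) \<and> - Q x = Q (f x)"
      using uniq[of "P x" "- Q x" "f x"] PQ(1)[of x] PQ(2)[of x] So by (simp add: subspace_neg)
    then have "f (f x) = P x + Q x" unfolding f_def by (metis diff_minus_eq_add)
    then show "(f \<circ> f) x = id x" using PQ(3)[of x] by (metis comp_apply id_apply)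
  qed
  ultimately have ex: "orthogonal_transformation f \<and> f \<circ> f = id \<and>
              (\<forall>x\<in>S. f x = x) \<and> (\<forall>x\<in>S\<^sup>\<bottom>. f x = - x)"
    by (auto simp: orthogonal_transformation_def)
  show ?thesis
  proof (rule ex1I[of _ f])
    show "orthogonal_transformation f \<and> f \<circ> f = id \<and>
              (\<forall>x\<in>S. f x = x) \<and> (\<forall>x\<in>S\<^sup>\<bottom>. f x = - x)" by (rule ex)
  next
    fix g
    assume g: "orthogonal_transformation g \<and> g \<circ> g = id \<and>
              (\<forall>x\<in>S. g x = x) \<and> (\<forall>x\<in>S\<^sup>\<bottom>. g x = - x)"
    show "g = f"
    proof
      fix x
      have "g x = g (P x + Q x)" using PQ(3)[of x] by (rule arg_cong)
      also have "\<dots> = g (P x) + g (Q x)"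
        using g linear_add[of g] by (simp add: orthogonal_transformation_def)
      finally show "g x = f x" using g PQ(1)[of x] PQ(2)[of x] by (simp add: f_def)
    qed
  qed
qed

lemmas inversion_props = theI'[OF inversion_ex1, folded inversion_def]

end

theory Submission
  imports Defs
begin

text \<open>
  The action is free, so there is a sign function \<open>s\<close> on \<open>V\<close> that changes sign under the nontrivial
  element of \<open>Z2\<close>. Replacing each point \<open>q i\<close> by \<open>s i *\<^sub>R q i\<close> turns symmetry with respect to the
  inversion in \<open>S1\<close> into symmetry with respect to its negative, which is the inversion in the
  orthogonal complement of \<open>S1\<close>. As this complement has the dimension of \<open>S2\<close>, an orthogonal map
  carries it onto \<open>S2\<close>. Neither antipodal flips (applied to points and velocities alike) nor
  orthogonal maps affect motions, trivial motions or great circles.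
\<close>

section \<open>Inversions and orthogonal complements\<close>

lemma dim_orthogonal_comp:
  fixes S :: "'a::euclidean_space set"
  assumes "subspace S"
  shows "dim (S\<^sup>\<bottom>) + dim S = DIM('a)"
  using dim_subspace_orthogonal_to_vectors[OF assms subspace_UNIV]
  by (simp add: orthogonal_comp_def)

lemma
  fixes S :: "(real^'n) set"
  assumes S: "subspace S"
  shows orthogonal_transformation_inversion: "orthogonal_transformation (inversion S)"
    and inversion_inversion: "inversion S (inversion S x) = x"
    and inversion_in: "x \<in> S \<Longrightarrow> inversion S x = x"
    and inversion_orthogonal_comp: "x \<in> S\<^sup>\<bottom> \<Longrightarrow> inversion S x = - x"
  using inversion_props[OF S] by (auto simp: fun_eq_iff)

text \<open>For \<open>x = y + z\<close> split along \<open>S\<close> and its complement, the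
  inversion gives \<open>y - z\<close>. Half of the two vectors below are thus the orthogonal
  projections of \<open>x\<close>.\<close>

lemma
  fixes S :: "(real^'n) set" and x :: "real^'n"
  assumes S: "subspace S"
  shows inversion_plus_in: "x + inversion S x \<in> S"
    and inversion_minus_in: "x - inversion S x \<in> S\<^sup>\<bottom>"
proof -
  obtain y z where yz: "y \<in> S" "z \<in> S\<^sup>\<bottom>" "x = y + z"
    using subspace_sum_orthogonal_comp[OF S] set_plus_elim[of x S "S\<^sup>\<bottom>"] by (metis UNIV_I)
  have "inversion S x = y - z"
    using yz orthogonal_transformation_inversion[OF S]
    by (simp add: orthogonal_transformation_def linear_add
        inversion_in[OF S] inversion_orthogonal_comp[OF S])
  then have "x + inversion S x = 2 *\<^sub>R y" "x - inversion S x = 2 *\<^sub>R z"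
    using yz by (simp_all add: scaleR_2)
  then show "x + inversion S x \<in> S" "x - inversion S x \<in> S\<^sup>\<bottom>"
    using yz S subspace_orthogonal_comp[of S] by (simp_all add: subspace_scale)
qed

text \<open>The negated inversion in \<open>S\<close> fixes \<open>S\<^sup>\<bottom>\<close> and
  negates \<open>S\<close>. An orthogonal \<open>f\<close> that carries
  \<open>S\<^sup>\<bottom>\<close> onto \<open>T\<close> and \<open>S\<close> onto
  \<open>T\<^sup>\<bottom>\<close> conjugates it into the inversion in \<open>T\<close>.\<close>

lemma inversion_conjugate_negative:
  fixes S T :: "(real^'n) set"
  assumes S: "subspace S" and T: "subspace T" and dim: "dim S + dim T = CARD('n)"
  obtains f where "orthogonal_transformation f"
    and "\<And>x. inversion T (f x) = - f (inversion S x)"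
proof -
  have "dim S = dim (T\<^sup>\<bottom>)" "dim (S\<^sup>\<bottom>) = dim T"
    using dim dim_orthogonal_comp[OF S] dim_orthogonal_comp[OF T] by auto
  then obtain a b :: "real^'n \<Rightarrow> real^'n"
    where a: "linear a" "a ` S = T\<^sup>\<bottom>" "\<And>x. x \<in> S \<Longrightarrow> norm (a x) = norm x"
      and b: "linear b" "b ` (S\<^sup>\<bottom>) = T" "\<And>x. x \<in> S\<^sup>\<bottom> \<Longrightarrow> norm (b x) = norm x"
    using isometry_subspaces[OF S subspace_orthogonal_comp]
      isometry_subspaces[OF subspace_orthogonal_comp T] by metis
  \<comment> \<open>The orthogonal projections onto \<open>S\<close> and its complement, written
    through the inversion so that linearity and their behaviour under it can be computed;
    \<open>f\<close> glues \<open>a\<close> and \<open>b\<close> along them.\<close>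
  define P where "P x = (1/2) *\<^sub>R (x + inversion S x)" for x
  define Q where "Q x = (1/2) *\<^sub>R (x - inversion S x)" for x
  define f where "f x = a (P x) + b (Q x)" for x
  have lin: "linear (inversion S)" "linear (inversion T)"
    using orthogonal_transformation_inversion S T by (auto simp: orthogonal_transformation_def)
  have PS: "P x \<in> S" and QS: "Q x \<in> S\<^sup>\<bottom>" and PQ: "P x + Q x = x" for x
    unfolding P_def Q_def using inversion_plus_in[OF S] inversion_minus_in[OF S]
      S subspace_orthogonal_comp[of S]
    by (auto intro: subspace_scale simp flip: scaleR_add_right simp: scaleR_2[symmetric])
  have aT: "a (P x) \<in> T\<^sup>\<bottom>" and bT: "b (Q x) \<in> T" for x
    using PS QS a b by blast+
  have "linear P" "linear Q"
    unfolding P_def Q_def by (intro linearI; simp add: linear_add[OF lin(1)]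
        linear_scale[OF lin(1)] algebra_simps)+
  then have "linear f"
    using a(1) b(1) unfolding f_def
    by (intro linear_compose_add linear_compose[unfolded o_def, of P a]
        linear_compose[unfolded o_def, of Q b])
  \<comment> \<open>\<open>a\<close> and \<open>b\<close> are known to be isometric only on their
    own summands; Pythagoras, applied in source and target, combines them.\<close>
  moreover have "norm (f x) = norm x" for x
  proof -
    have "orthogonal (a (P x)) (b (Q x))" "orthogonal (P x) (Q x)"
      using aT[of x] bT[of x] PS[of x] QS[of x]
      unfolding orthogonal_comp_def by (blast intro: orthogonal_commute[THEN iffD1])+
    then have "(norm (f x))\<^sup>2 = (norm (P x + Q x))\<^sup>2"
      unfolding f_def by (simp add: norm_add_Pythagorean a(3)[OF PS] b(3)[OF QS])
    then show ?thesis by (simp add: PQ)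
  qed
  ultimately have "orthogonal_transformation f"
    by (simp add: orthogonal_transformation)
  \<comment> \<open>Both sides equal \<open>b (Q x) - a (P x)\<close>.\<close>
  moreover have "inversion T (f x) = - f (inversion S x)" for x
  proof -
    have "P (inversion S x) = P x" "Q (inversion S x) = - Q x"
      by (simp_all add: P_def Q_def inversion_inversion[OF S] algebra_simps)
    then show ?thesis
      by (simp add: f_def linear_add[OF lin(2)] inversion_in[OF T bT]
          inversion_orthogonal_comp[OF T aT] linear_neg[OF b(1)])
  qed
  ultimately show thesis using that by blast
qed

section \<open>Homomorphisms out of \<open>Z2\<close> and signs on free orbits\<close>

lemma carrier_Z2: "carrier Z2 = {0, 1}"
  by (auto simp: carrier_integer_mod_group)

lemma iso_inversion_group:
  fixes S :: "(real^'n) set"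
  assumes S: "subspace S" and \<tau>: "\<tau> \<in> iso Z2 (inversion_group S)"
  shows "\<tau> 0 = id" and "\<tau> 1 = inversion S"
proof -
  have bij: "bij_betw \<tau> {0, 1} {id, inversion S}"
    using \<tau> by (simp add: iso_def carrier_Z2 inversion_group_def)
  then have in': "\<tau> 0 \<in> {id, inversion S}" "\<tau> 1 \<in> {id, inversion S}" "\<tau> 0 \<noteq> \<tau> 1"
    by (auto simp: bij_betw_def)
  \<comment> \<open>\<open>\<tau> 0\<close> is idempotent. If it is the inversion, an involution,
    then it equals its own square \<open>id\<close> all the same.\<close>
  have "\<tau> ((0 + 0) mod 2) = \<tau> 0 \<circ> \<tau> 0"
    using \<tau> hom_mult[of \<tau> Z2 "inversion_group S" 0 0]
    by (simp add: iso_def inversion_group_def)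
  then show "\<tau> 0 = id"
    using in' inversion_props[OF S] by auto
  then show "\<tau> 1 = inversion S"
    using in' by auto
qed

text \<open>\<theta> sends \<open>0\<close> to an idempotent bijection of \<open>V\<close>, which
  injectivity makes the identity there; \<open>1 + 1 = 0\<close> then makes
  \<open>\<theta> 1\<close> an involution on \<open>V\<close>.\<close>

lemma hom_graph_Aut:
  assumes \<theta>: "\<theta> \<in> hom Z2 (graph_Aut V E)" and i: "i \<in> V"
  shows "\<theta> 0 i = i" and "\<theta> 1 i \<in> V" and "\<theta> 1 (\<theta> 1 i) = i"
proof -
  have Bij: "\<theta> \<gamma> \<in> Bij V" if "\<gamma> \<in> {0, 1}" for \<gamma>
    using hom_in_carrier[OF \<theta>, of \<gamma>] that by (auto simp: carrier_Z2 graph_Aut_def)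
  have mult: "\<theta> ((\<gamma> + \<delta>) mod 2) = compose V (\<theta> \<gamma>) (\<theta> \<delta>)" if "\<gamma> \<in> {0, 1}" "\<delta> \<in> {0, 1}" for \<gamma> \<delta>
    using hom_mult[OF \<theta>, of \<gamma> \<delta>] that Bij[of \<gamma>] Bij[of \<delta>]
    by (simp add: carrier_Z2 graph_Aut_def BijGroup_def)
  show \<theta>1: "\<theta> 1 i \<in> V"
    using Bij[of 1] i Bij_imp_funcset by fastforce
  have \<theta>0: "\<theta> 0 i \<in> V"
    using Bij[of 0] i Bij_imp_funcset by fastforce
  have "\<theta> 0 (\<theta> 0 i) = \<theta> 0 i"
    using fun_cong[OF mult[of 0 0], of i] i by (simp add: compose_def)
  then show "\<theta> 0 i = i"
    using Bij[of 0] i \<theta>0 by (auto simp: Bij_def bij_betw_def dest: inj_onD)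
  then show "\<theta> 1 (\<theta> 1 i) = i"
    using fun_cong[OF mult[of 1 1], of i] i by (simp add: compose_def)
qed

text \<open>Each orbit \<open>{i, h i}\<close> in \<open>V\<close> has two distinct points: a chosen
  one gets the sign 1, the other -1.\<close>

lemma ex_alternating_sign:
  assumes inv: "\<And>i. i \<in> V \<Longrightarrow> h (h i) = i" and free: "\<And>i. i \<in> V \<Longrightarrow> h i \<noteq> i"
  obtains s :: "'v \<Rightarrow> real"
  where "\<And>i. s i * s i = 1" and "\<And>i. i \<in> V \<Longrightarrow> s (h i) = - s i"
proof
  \<comment> \<open>The choice depends only on the set, so \<open>i\<close> and \<open>h i\<close>
    get the same representative.\<close>
  define r where "r i = (SOME j. j \<in> {i, h i})" for i
  define s :: "'v \<Rightarrow> real" where "s i = (if r i = i then 1 else -1)" for i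
  show "s i * s i = 1" for i
    by (simp add: s_def)
  show "s (h i) = - s i" if "i \<in> V" for i
  proof -
    have "r (h i) = r i"
      using inv[OF that] by (simp add: r_def insert_commute disj_commute)
    moreover have "r i \<in> {i, h i}"
      unfolding r_def by (rule someI[of _ i]) simp
    ultimately show ?thesis
      using free[OF that] by (auto simp: s_def)
  qed
qed

section \<open>Frameworks and motions under sign flips and an orthogonal map\<close>

definition signed_image :: "('v \<Rightarrow> real) \<Rightarrow> (real^'n \<Rightarrow> real^'n) \<Rightarrow> ('v \<Rightarrow> real^'n) \<Rightarrow> 'v \<Rightarrow> real^'n"
  where "signed_image s f p i = s i *\<^sub>R f (p i)"

context
  fixes s :: "'v \<Rightarrow> real" and f :: "real^'n \<Rightarrow> real^'n"
  assumes s: "\<And>i. s i * s i = 1" and f: "orthogonal_transformation f"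
begin

lemma s_nonzero: "s i \<noteq> 0"
  using s[of i] by auto

lemma abs_s: "\<bar>s i\<bar> = 1"
  using s[of i] by (metis abs_1 abs_mult abs_mult_self_eq abs_ge_zero abs_square_eq_1 power2_eq_square)

text \<open>Lets every motion of the image framework be pulled back to the original one. Signs are
  their own inverses, so the witness inverts \<open>f\<close> and reuses \<open>s\<close>.\<close>

lemma signed_image_surj: "\<exists>p. signed_image s f p = p'"
proof
  show "signed_image s f (\<lambda>i. s i *\<^sub>R inv_into UNIV f (p' i)) = p'"
    using orthogonal_transformation_surj[OF f]
    by (auto simp: fun_eq_iff signed_image_def orthogonal_transformation_scaleR[OF f]
        surj_f_inv_f s)
qed

text \<open>Both terms of the equation of an edge acquire the same nonzero factor
  \<open>s i * s j\<close>.\<close>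

lemma infinitesimal_motion_signed_image:
  "infinitesimal_motion V E (signed_image s f q) (signed_image s f p) \<longleftrightarrow>
   infinitesimal_motion V E q p"
proof -
  have inner: "signed_image s f q i \<bullet> signed_image s f p j = (s i * s j) * (q i \<bullet> p j)" for i j
    using f by (simp add: signed_image_def orthogonal_transformation_def)
  have "signed_image s f q i \<bullet> signed_image s f p j + signed_image s f q j \<bullet> signed_image s f p i
      = (s i * s j) * (q i \<bullet> p j + q j \<bullet> p i)" for i j
    unfolding inner by (simp add: algebra_simps)
  then show ?thesis
    unfolding infinitesimal_motion_def by (simp add: inner s_nonzero)
qed

text \<open>Conjugating the skew matrix \<open>A\<close> by the matrix of \<open>f\<close> keeps it
  skew, and \<open>s i\<close> scales point and velocity alike.\<close>

lemma trivial_motion_signed_image: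
  assumes "trivial_motion V q p"
  shows "trivial_motion V (signed_image s f q) (signed_image s f p)"
proof -
  obtain A :: "real^'n^'n" where A: "transpose A = - A" "\<And>i. i \<in> V \<Longrightarrow> p i = A *v q i"
    using assms unfolding trivial_motion_def by blast
  define F where "F = matrix f"
  have fF: "f x = F *v x" for x
    using f by (simp add: F_def matrix_works orthogonal_transformation_linear)
  have FF: "transpose F ** F = mat 1"
    using f by (simp add: F_def orthogonal_transformation_matrix orthogonal_matrix)
  have "transpose (F ** A ** transpose F) = F ** transpose A ** transpose F"
    by (simp add: matrix_transpose_mul matrix_mul_assoc)
  also have "\<dots> = - (F ** A ** transpose F)"
    unfolding A(1) by (simp add: vec_eq_iff matrix_matrix_mult_def sum_negf)
  finally have "transpose (F ** A ** transpose F) = - (F ** A ** transpose F)" .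
  moreover have "signed_image s f p i = (F ** A ** transpose F) *v signed_image s f q i"
    if "i \<in> V" for i
  proof -
    have "(F ** A ** transpose F) *v (F *v q i) = (F ** A ** (transpose F ** F)) *v q i"
      by (simp add: matrix_vector_mul_assoc matrix_mul_assoc)
    then show ?thesis
      using A(2)[OF that]
      by (simp add: signed_image_def fF FF matrix_vector_mult_scaleR matrix_vector_mul_assoc)
  qed
  ultimately show ?thesis
    unfolding trivial_motion_def by blast
qed

lemma infinitesimally_rigid_signed_image:
  assumes "infinitesimally_rigid V E q"
  shows "infinitesimally_rigid V E (signed_image s f q)"
  using assms unfolding infinitesimally_rigid_def
  by (metis signed_image_surj infinitesimal_motion_signed_image trivial_motion_signed_image)

lemma spherical_framework_signed_image:
  assumes "spherical_framework V q"
  shows "spherical_framework V (signed_image s f q)"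
proof -
  have q: "\<And>i. i \<in> V \<Longrightarrow> norm (q i) = 1" and span: "span (q ` V) = UNIV"
    using assms by (auto simp: spherical_framework_def)
  have "f ` q ` V \<subseteq> span (signed_image s f q ` V)"
  proof clarify
    fix i assume "i \<in> V"
    \<comment> \<open>A second multiplication by \<open>s i\<close> undoes the flip.\<close>
    then have "s i *\<^sub>R signed_image s f q i \<in> span (signed_image s f q ` V)"
      by (simp add: span_base span_scale)
    then show "f (q i) \<in> span (signed_image s f q ` V)"
      by (simp add: signed_image_def s)
  qed
  then have "span (f ` q ` V) \<subseteq> span (signed_image s f q ` V)"
    by (simp add: span_minimal)
  moreover have "span (f ` q ` V) = UNIV"
    using f orthogonal_transformation_surj[OF f]
    by (simp add: linear_span_image orthogonal_transformation_linear span)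
  ultimately show ?thesis
    using q by (auto simp: spherical_framework_def signed_image_def abs_s
        orthogonal_transformation_norm[OF f])
qed

text \<open>The injective \<open>f\<close> maps the plane of the circle to a plane, and a plane
  through the origin contains the antipodes of its unit vectors.\<close>

lemma great_circle_signed_image:
  assumes "great_circle C" "q ` X \<subseteq> C"
  shows "\<exists>C'. great_circle C' \<and> signed_image s f q ` X \<subseteq> C'"
proof -
  obtain W where W: "subspace W" "dim W = 2" "C = sphere 0 1 \<inter> W"
    using assms unfolding great_circle_def by blast
  have lin: "linear f"
    using f by (rule orthogonal_transformation_linear)
  have "great_circle (sphere 0 1 \<inter> f ` W)"
    unfolding great_circle_def
    using W lin dim_image_eq[OF lin, of W] orthogonal_transformation_inj[OF f]
    by (metis linear_subspace_image inj_on_subset subset_UNIV)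
  moreover have "signed_image s f q i \<in> sphere 0 1 \<inter> f ` W" if "i \<in> X" for i
  proof -
    have "q i \<in> W" "norm (q i) = 1"
      using assms(2) that W by auto
    moreover have "subspace (f ` W)"
      using W lin by (simp add: linear_subspace_image)
    ultimately show ?thesis
      by (simp add: signed_image_def abs_s orthogonal_transformation_norm[OF f] subspace_scale)
  qed
  ultimately show ?thesis by blast
qed

context
  fixes \<theta> :: "int \<Rightarrow> 'v \<Rightarrow> 'v" and V :: "'v set" and \<tau> \<tau>' :: "int \<Rightarrow> real^'n \<Rightarrow> real^'n"
  assumes \<theta>: "\<And>i. i \<in> V \<Longrightarrow> \<theta> 0 i = i" and alt: "\<And>i. i \<in> V \<Longrightarrow> s (\<theta> 1 i) = - s i"
    and \<tau>: "\<tau> 0 = id" "\<tau>' 0 = id" and lin: "linear (\<tau>' 1)"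
    and conj: "\<And>x. \<tau>' 1 (f x) = - f (\<tau> 1 x)"
begin

text \<open>At the nontrivial element, the minus sign from \<open>conj\<close> cancels the one from
  \<open>alt\<close>, and injectivity of \<open>f\<close> removes \<open>f\<close>. As
  \<open>p\<close> is arbitrary, this covers placements and velocities.\<close>

lemma Z2_symmetric_signed_image:
  "Z2_symmetric V \<theta> \<tau>' (signed_image s f p) \<longleftrightarrow> Z2_symmetric V \<theta> \<tau> p"
proof -
  have "f x = f y \<longleftrightarrow> x = y" for x y
    using orthogonal_transformation_inj[OF f] by (simp add: inj_eq)
  then show ?thesis
    by (auto simp: Z2_symmetric_def carrier_Z2 signed_image_def \<theta> \<tau> alt conj
        linear_scale[OF lin] s_nonzero)
qed

text \<open>A symmetric motion of the image pulls back to a symmetric motion, which is trivial;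
  triviality is then pushed forward.\<close>

lemma forced_rigid_signed_image:
  assumes "forced_Z2_symmetric_infinitesimally_rigid V E \<theta> \<tau> q"
  shows "forced_Z2_symmetric_infinitesimally_rigid V E \<theta> \<tau>' (signed_image s f q)"
  using assms unfolding forced_Z2_symmetric_infinitesimally_rigid_def
  by (metis signed_image_surj infinitesimal_motion_signed_image trivial_motion_signed_image
      Z2_symmetric_signed_image)

end

end

section \<open>Transfer between inversions in subspaces of complementary dimensions\<close>

lemma complementary_inversion_transfer:
  fixes S T :: "(real^'n) set"
  assumes \<theta>: "\<theta> \<in> hom Z2 (graph_Aut V E)" and free: "acts_freely \<theta> V"
    and S: "subspace S" and T: "subspace T" and dim: "dim S + dim T = CARD('n)"
    and \<tau>: "\<tau> \<in> iso Z2 (inversion_group S)" and \<tau>': "\<tau>' \<in> iso Z2 (inversion_group T)"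
    and q: "spherical_framework V q" "Z2_symmetric V \<theta> \<tau> q"
      "\<exists>C. great_circle C \<and> q ` X \<subseteq> C"
  obtains q' where "spherical_framework V q'" "Z2_symmetric V \<theta> \<tau>' q'"
    "\<exists>C. great_circle C \<and> q' ` X \<subseteq> C"
    "infinitesimally_rigid V E q \<Longrightarrow> infinitesimally_rigid V E q'"
    "forced_Z2_symmetric_infinitesimally_rigid V E \<theta> \<tau> q \<Longrightarrow>
     forced_Z2_symmetric_infinitesimally_rigid V E \<theta> \<tau>' q'"
proof -
  obtain f where f: "orthogonal_transformation f"
    and conj: "\<And>x. inversion T (f x) = - f (inversion S x)"
    using inversion_conjugate_negative[OF S T dim] by blast
  have "\<theta> 1 i \<noteq> i" if "i \<in> V" for i
    using free that by (simp add: acts_freely_def carrier_Z2)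
  then obtain s :: "_ \<Rightarrow> real" where s: "\<And>i. s i * s i = 1"
    and alt: "\<And>i. i \<in> V \<Longrightarrow> s (\<theta> 1 i) = - s i"
    using ex_alternating_sign[of V "\<theta> 1"] hom_graph_Aut(3)[OF \<theta>] by metis
  note iso = iso_inversion_group[OF S \<tau>] iso_inversion_group[OF T \<tau>']
  have lin: "linear (\<tau>' 1)"
    using orthogonal_transformation_inversion[OF T] iso
    by (simp add: orthogonal_transformation_linear)
  have conj': "\<tau>' 1 (f x) = - f (\<tau> 1 x)" for x
    by (simp add: iso conj)
  note sym = s f hom_graph_Aut(1)[OF \<theta>] alt iso(1,3) lin conj'
  \<comment> \<open>A single placement serves both kinds of rigidity.\<close>
  show thesis
    by (rule that[of "signed_image s f q"])
      (use q in \<open>auto intro: spherical_framework_signed_image[OF s f]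
         great_circle_signed_image[OF s f] infinitesimally_rigid_signed_image[OF s f]
         forced_rigid_signed_image[where s = s and f = f and \<theta> = \<theta> and \<tau> = \<tau> and \<tau>' = \<tau>', OF sym]
         simp: Z2_symmetric_signed_image[where s = s and f = f and \<theta> = \<theta> and \<tau> = \<tau> and \<tau>' = \<tau>', OF sym]\<close>)
qed

theorem theorem6p1:
  fixes V :: "'v set" and E :: "'v set set" and X :: "'v set"
    and \<theta> :: "int \<Rightarrow> 'v \<Rightarrow> 'v"
    and S1 S2 :: "(real^'n) set"
    and \<tau> \<tau>' :: "int \<Rightarrow> real^'n \<Rightarrow> real^'n"
    and d k1 k2 :: nat
  assumes "CARD('n) = d + 1"
    and "finite_graph V E"
    and "\<theta> \<in> hom Z2 (graph_Aut V E)" and "acts_freely \<theta> V"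
    and "subspace S1" and "S1 \<noteq> UNIV" and "dim S1 = k1"
    and "subspace S2" and "S2 \<noteq> UNIV" and "dim S2 = k2"
    and "k1 + k2 = d + 1" and "S1 \<inter> S2 = {0}"
    and "X \<subseteq> V"
    and "\<tau> \<in> iso Z2 (inversion_group S1)"
    and "\<tau>' \<in> iso Z2 (inversion_group S2)"
  shows "((\<exists>q. spherical_framework V q \<and> Z2_symmetric V \<theta> \<tau> q \<and>
               infinitesimally_rigid V E q \<and> (\<exists>C. great_circle C \<and> q ` X \<subseteq> C)) \<longleftrightarrow>
          (\<exists>q. spherical_framework V q \<and> Z2_symmetric V \<theta> \<tau>' q \<and>
               infinitesimally_rigid V E q \<and> (\<exists>C. great_circle C \<and> q ` X \<subseteq> C)))
       \<and> ((\<exists>q. spherical_framework V q \<and> Z2_symmetric V \<theta> \<tau> q \<and>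
               forced_Z2_symmetric_infinitesimally_rigid V E \<theta> \<tau> q \<and>
               (\<exists>C. great_circle C \<and> q ` X \<subseteq> C)) \<longleftrightarrow>
          (\<exists>q. spherical_framework V q \<and> Z2_symmetric V \<theta> \<tau>' q \<and>
               forced_Z2_symmetric_infinitesimally_rigid V E \<theta> \<tau>' q \<and>
               (\<exists>C. great_circle C \<and> q ` X \<subseteq> C)))"
proof -
  \<comment> \<open>The transfer is used from \<open>S1\<close> to \<open>S2\<close> and back, so
    the dimension sum is recorded in both orders.\<close>
  have dim: "dim S1 + dim S2 = CARD('n)" "dim S2 + dim S1 = CARD('n)"
    using assms by simp_all
  note fwd = complementary_inversion_transfer
    [OF assms(3,4,5,8) dim(1) assms(14,15), of _ X]
  note bwd = complementary_inversion_transfer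
    [OF assms(3,4,8,5) dim(2) assms(15,14), of _ X]
  show ?thesis
    by (intro conjI iffI; elim exE conjE)
      (metis fwd, metis bwd, metis fwd, metis bwd)
qed

end
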